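(* If $j$ and $n$ are integers such that $0 \leq j \leq n - 2$, then $$\sum_{k=0}^{j} \binom{n}{k} = \left\lfloor \frac{(2^n+1)^n}{2^{n(n-j)}} \right\rfloor \bmod (2^n-1).$$
   Context: For an integer $a$ and a positive integer $b$, $a \bmod b$ denotes the remainder $a - b\lfloor a/b \rfloor \in \{0, \ldots, b-1\}$. *)

theory Defs
  imports Complex_Main
begin

end

(* Put B = 2 ^ n. The numbers n choose i with i < n are the digits of (B + 1) ^ n in base B,
   so dividing by B ^ (n - j) and rounding down keeps exactly the digits at the top j + 1
   positions, which are n choose 0, ..., n choose j. Modulo B - 1 a number is congruent to
   its digit sum, and for j \<le> n - 2 this digit sum is already smaller than B - 1. *)
theory Submission
  imports Defs "HOL-Number_Theory.Cong"
begin

lemma digit_sum_less_power: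
  fixes d :: "nat \<Rightarrow> int" and b :: int
  assumes "b \<ge> 0" and "\<And>i. i < m \<Longrightarrow> d i < b"
  shows "(\<Sum>i<m. d i * b ^ i) < b ^ m"
  using assms(2)
proof (induction m)
  case 0
  then show ?case by simp
next
  case (Suc m)
  \<comment> \<open>A top digit of at most \<open>b - 1\<close> leaves a gap of \<open>b ^ m\<close>
    below \<open>b ^ Suc m\<close>, which the lower digits cannot fill.\<close>
  have "d m * b ^ m \<le> (b - 1) * b ^ m"
    using Suc.prems[of m] assms(1) by (intro mult_right_mono) auto
  moreover have "(\<Sum>i<m. d i * b ^ i) < b ^ m"
    using Suc by simp
  ultimately show ?case
    by (simp add: algebra_simps)
qed

text \<open>The whole row sums to \<open>2 ^ n\<close>, and the entries at \<open>n - 1\<close> and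
  \<open>n\<close>, both beyond \<open>j\<close>, take away at least 2.\<close>

lemma sum_choose_less:
  assumes "j + 2 \<le> n"
  shows "(\<Sum>k=0..j. int (n choose k)) < 2 ^ n - 1"
proof -
  have "(\<Sum>k\<in>{0..j}. int (n choose k)) + (\<Sum>k\<in>{n - 1, n}. int (n choose k))
      = (\<Sum>k\<in>{0..j} \<union> {n - 1, n}. int (n choose k))"
    using assms by (intro sum.union_disjoint[symmetric]) auto
  also have "\<dots> \<le> (\<Sum>k\<le>n. int (n choose k))"
    using assms by (intro sum_mono2) auto
  also have "\<dots> = 2 ^ n"
    using choose_row_sum[of n] by (simp flip: of_nat_sum)
  finally have "(\<Sum>k=0..j. int (n choose k)) + (int (n choose (n - 1)) + 1) \<le> 2 ^ n"
    using assms by simp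
  moreover have "n choose (n - 1) > 0"
    by simp
  ultimately show ?thesis
    by linarith
qed

text \<open>The row sum \<open>2 ^ n\<close> also contains the entry 1 at position \<open>n\<close>,
  which differs from \<open>i\<close>; hence strictness.\<close>

lemma choose_less_power:
  assumes "i < n"
  shows "int (n choose i) < 2 ^ n"
proof -
  have "(\<Sum>k\<in>{i, n}. n choose k) \<le> (\<Sum>k\<le>n. n choose k)"
    using assms by (intro sum_mono2) auto
  then have "n choose i < 2 ^ n"
    using assms by (simp add: choose_row_sum)
  then show ?thesis
    by (metis of_nat_less_iff of_nat_numeral of_nat_power)
qed

text \<open>Cut the expansion at exponent \<open>n - j\<close>: the upper part is a multiple of
  \<open>b ^ (n - j)\<close>, and the digit bound keeps the lower part from carrying into the
  quotient.\<close>

lemma binomial_div_power: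
  fixes b :: int
  assumes "j \<le> n" and digits: "\<And>i. i < n - j \<Longrightarrow> int (n choose i) < b" and "b > 0"
  shows "(b + 1) ^ n div b ^ (n - j) = (\<Sum>k=0..j. int (n choose k) * b ^ (j - k))"
proof -
  define m where "m = n - j"
  define low where "low = (\<Sum>i<m. int (n choose i) * b ^ i)"
  have "(b + 1) ^ n = (\<Sum>i\<le>n. int (n choose i) * b ^ i)"
    using binomial_ring[of b 1 n] by simp
  also have "{..n} = {..<m} \<union> {m..n}"
    using assms(1) by (auto simp: m_def)
  also have "(\<Sum>i\<in>\<dots>. int (n choose i) * b ^ i) = low + (\<Sum>i=m..n. int (n choose i) * b ^ i)"
    unfolding low_def by (intro sum.union_disjoint) auto
  \<comment> \<open>The symmetry of the row, \<open>i = n - k\<close>, turns the top exponents into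
    the first \<open>j + 1\<close> coefficients.\<close>
  also have "(\<Sum>i=m..n. int (n choose i) * b ^ i)
      = (\<Sum>k=0..j. int (n choose k) * b ^ (n - k))"
    using assms(1)
    by (intro sum.reindex_bij_witness[of _ "\<lambda>k. n - k" "\<lambda>k. n - k"])
       (auto simp: m_def simp flip: binomial_symmetric)
  also have "\<dots> = (\<Sum>k=0..j. int (n choose k) * b ^ (j - k)) * b ^ m"
    using assms(1)
    by (auto simp: sum_distrib_right m_def mult.assoc simp flip: power_add intro!: sum.cong)
  finally have eq: "(b + 1) ^ n = low + (\<Sum>k=0..j. int (n choose k) * b ^ (j - k)) * b ^ m" .
  have "low < b ^ m"
    unfolding low_def using digits assms(3) by (intro digit_sum_less_power) (auto simp: m_def)
  moreover have "low \<ge> 0"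
    unfolding low_def using assms(3) by (intro sum_nonneg) auto
  ultimately show ?thesis
    using assms(3) unfolding eq m_def[symmetric] by simp
qed

theorem theorem3p1:
  fixes j n :: nat
  assumes "int j \<le> int n - 2"
  shows "(\<Sum>k=0..j. int (n choose k))
           = \<lfloor>((2::real) ^ n + 1) ^ n / 2 ^ (n * (n - j))\<rfloor> mod (2 ^ n - 1)"
proof -
  \<comment> \<open>The hypothesis subtracts in the integers, so it forces \<open>n\<close> to be at
    least 2.\<close>
  have jn: "j + 2 \<le> n"
    using assms by linarith
  let ?b = "2 ^ n :: int"
  \<comment> \<open>As a quotient of two integers cast to reals, the fraction has integer
    \<open>div\<close> as its floor.\<close>
  have "((2::real) ^ n + 1) ^ n / 2 ^ (n * (n - j))
      = real_of_int ((?b + 1) ^ n) / real_of_int (?b ^ (n - j))"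
    by (simp add: power_mult)
  then have "\<lfloor>((2::real) ^ n + 1) ^ n / 2 ^ (n * (n - j))\<rfloor> = (?b + 1) ^ n div ?b ^ (n - j)"
    by (simp only: floor_divide_of_int_eq)
  also have "\<dots> = (\<Sum>k=0..j. int (n choose k) * ?b ^ (j - k))"
    using jn by (intro binomial_div_power choose_less_power) auto
  finally have floor_eq: "\<lfloor>((2::real) ^ n + 1) ^ n / 2 ^ (n * (n - j))\<rfloor>
      = (\<Sum>k=0..j. int (n choose k) * ?b ^ (j - k))" .
  have "[?b = 1] (mod (?b - 1))"
    by (simp add: cong_iff_dvd_diff)
  then have "[(\<Sum>k=0..j. int (n choose k) * ?b ^ (j - k))
      = (\<Sum>k=0..j. int (n choose k) * 1 ^ (j - k))] (mod (?b - 1))"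
    by (intro cong_sum cong_mult cong_pow cong_refl)
  then have "(\<Sum>k=0..j. int (n choose k) * ?b ^ (j - k)) mod (?b - 1)
      = (\<Sum>k=0..j. int (n choose k)) mod (?b - 1)"
    by (simp add: cong_def)
  also have "\<dots> = (\<Sum>k=0..j. int (n choose k))"
    using sum_choose_less[OF jn] by (intro mod_pos_pos_trivial sum_nonneg) auto
  finally show ?thesis
    by (simp add: floor_eq)
qed

end
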